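(* Let $0 < \varepsilon < 1$ and $0 \leq a < b$, and let $n$ be a positive integer. Let $X_1, \ldots, X_n$ be independent and identically distributed Poisson random variables with mean $\lambda \in [a,b]$, and let $\widehat{\lambda}_n = \frac{1}{n}\sum_{i=1}^n X_i$. Then the minimum of the coverage probability $\Pr\{ |\widehat{\lambda}_n - \lambda| < \varepsilon \}$ with respect to $\lambda \in [a,b]$ is achieved at (an element of) the finite set $$\{a, b\} \cup \left\{ \tfrac{\ell}{n} + \varepsilon \in (a,b) : \ell \in \mathbb{Z} \right\} \cup \left\{ \tfrac{\ell}{n} - \varepsilon \in (a,b) : \ell \in \mathbb{Z} \right\},$$ which has less than $2n(b-a) + 4$ elements.
   Context: For each $\lambda$, the probability $\Pr\{|\widehat{\lambda}_n - \lambda| < \varepsilon\}$ is computed under the assumption that $X_1,\ldots,X_n$ are i.i.d. Poisson with mean $\lambda$, i.e. $\Pr\{X_i = k\} = \frac{\lambda^k e^{-\lambda}}{k!}$ for $k = 0,1,\ldots$; so it is a function of $\lambda \in [a,b]$ with $n$ and $\varepsilon$ fixed. When $\lambda = 0$ (possible if $a = 0$), a Poisson variable of mean $0$ is identically $0$ almost surely. *)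

theory Defs
  imports "HOL-Probability.Probability"
begin

text \<open>
  The mass function is written out because \<open>poisson_pmf\<close> requires a positive rate. For rate 0,
  \<open>0 ^ 0 = 1\<close> makes it the point mass at 0; both links are proved below.
\<close>

definition iid_poisson :: "'a measure \<Rightarrow> (nat \<Rightarrow> 'a \<Rightarrow> nat) \<Rightarrow> nat \<Rightarrow> real \<Rightarrow> bool" where
  "iid_poisson M X n lam \<longleftrightarrow>
     prob_space M \<and>
     prob_space.indep_vars M (\<lambda>_. count_space UNIV) X {1..n} \<and>
     (\<forall>i\<in>{1..n}. \<forall>k. measure M {\<omega> \<in> space M. X i \<omega> = k} = lam ^ k * exp (- lam) / fact k)"

definition sample_mean :: "(nat \<Rightarrow> 'a \<Rightarrow> nat) \<Rightarrow> nat \<Rightarrow> 'a \<Rightarrow> real" where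
  "sample_mean X n \<omega> = (\<Sum>i=1..n. real (X i \<omega>)) / real n"

definition coverage :: "'a measure \<Rightarrow> (nat \<Rightarrow> 'a \<Rightarrow> nat) \<Rightarrow> nat \<Rightarrow> real \<Rightarrow> real \<Rightarrow> real" where
  "coverage M X n \<epsilon> lam = measure M {\<omega> \<in> space M. \<bar>sample_mean X n \<omega> - lam\<bar> < \<epsilon>}"

definition candidate_set :: "nat \<Rightarrow> real \<Rightarrow> real \<Rightarrow> real \<Rightarrow> real set" where
  "candidate_set n \<epsilon> a b =
     {a, b} \<union>
     {x \<in> {a<..<b}. \<exists>l::int. x = real_of_int l / real n + \<epsilon>} \<union>
     {x \<in> {a<..<b}. \<exists>l::int. x = real_of_int l / real n - \<epsilon>}"

lemma iid_poisson_distr: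
  assumes "iid_poisson M X n lam" "0 < lam" "i \<in> {1..n}"
  shows "distr M (count_space UNIV) (X i) = measure_pmf (poisson_pmf lam)"
proof -
  interpret prob_space M using assms(1) by (simp add: iid_poisson_def)
  have X: "X i \<in> measurable M (count_space UNIV)"
    using assms by (auto simp: iid_poisson_def indep_vars_def)
  show ?thesis
  proof (rule measure_eqI_countable[where A = UNIV])
    fix k :: nat
    have "emeasure (distr M (count_space UNIV) (X i)) {k} = emeasure M {\<omega> \<in> space M. X i \<omega> = k}"
      using X by (subst emeasure_distr) (auto intro!: arg_cong[where f = "emeasure M"])
    also have "\<dots> = ennreal (lam ^ k * exp (- lam) / fact k)"
      using assms by (simp add: emeasure_eq_measure iid_poisson_def)
    also have "\<dots> = emeasure (measure_pmf (poisson_pmf lam)) {k}"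
      using assms(2) by (simp add: emeasure_pmf_single mult.commute)
    finally show "emeasure (distr M (count_space UNIV) (X i)) {k} =
      emeasure (measure_pmf (poisson_pmf lam)) {k}" .
  qed auto
qed

lemma iid_poisson_zero:
  assumes "iid_poisson M X n 0" "i \<in> {1..n}"
  shows "AE \<omega> in M. X i \<omega> = 0"
proof -
  interpret prob_space M using assms(1) by (simp add: iid_poisson_def)
  have X: "X i \<in> measurable M (count_space UNIV)"
    using assms by (auto simp: iid_poisson_def indep_vars_def)
  have "prob {\<omega> \<in> space M. X i \<omega> = 0} = 1"
    using assms by (auto simp: iid_poisson_def)
  moreover have "{\<omega> \<in> space M. X i \<omega> = 0} \<in> events"
    using X by measurable
  ultimately show ?thesis
    by (subst (asm) prob_Collect_eq_1) auto
qed

end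

theory Submission
  imports Defs
begin

text \<open>
  The sum of the observations is Poisson with mean \<open>n\<lambda>\<close>, so the coverage probability is
  \<open>\<Sum>k\<in>K(\<lambda>). (n\<lambda>)^k e^(-n\<lambda>) / k!\<close>, where the set \<open>K(\<lambda>)\<close> of covered counts is an interval of
  naturals. Between two neighbouring candidates \<open>c < d\<close> the set \<open>K(\<lambda>)\<close> is a constant \<open>K\<close>, and
  \<open>K(c), K(d) \<subseteq> K\<close> because the defining inequality is strict. For fixed \<open>K = {g..<h}\<close> the derivative
  of the sum telescopes to a difference of two masses, which changes sign at most once, from
  positive to negative. Hence the sum at \<open>\<lambda>\<close> is at least its minimum over \<open>c\<close> and \<open>d\<close>, which
  dominates the smaller of the coverage probabilities at \<open>c\<close> and \<open>d\<close>.
\<close>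

section \<open>Poisson masses and their sums as functions of the mean\<close>

definition poisson_mass :: "real \<Rightarrow> nat \<Rightarrow> real" where
  "poisson_mass \<mu> k = \<mu> ^ k * exp (- \<mu>) / fact k"

definition covered :: "nat \<Rightarrow> real \<Rightarrow> real \<Rightarrow> nat set" where
  "covered n \<epsilon> lam = {k. \<bar>real k / real n - lam\<bar> < \<epsilon>}"

lemma poisson_mass_nonneg: "0 \<le> \<mu> \<Longrightarrow> 0 \<le> poisson_mass \<mu> k"
  by (simp add: poisson_mass_def)

text \<open>The binomial theorem divided by \<open>fact k\<close>, times the product of the
  exponentials. It makes the Poisson laws closed under convolution, as the induction in
  \<open>iid_poisson_sum\<close> requires.\<close>

lemma poisson_mass_add:
  "poisson_mass (\<mu> + \<nu>) k = (\<Sum>j\<le>k. poisson_mass \<mu> j * poisson_mass \<nu> (k - j))"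
proof -
  have "(\<mu> + \<nu>) ^ k /\<^sub>R fact k = (\<Sum>j\<le>k. (\<mu> ^ j /\<^sub>R fact j) * (\<nu> ^ (k - j) /\<^sub>R fact (k - j)))"
    by (rule exp_series_add_commuting) (simp add: mult.commute)
  moreover have "exp (- \<mu> - \<nu>) = exp (- \<mu>) * exp (- \<nu>)"
    by (simp flip: exp_add)
  ultimately have "poisson_mass (\<mu> + \<nu>) k =
      (\<Sum>j\<le>k. (\<mu> ^ j /\<^sub>R fact j) * (\<nu> ^ (k - j) /\<^sub>R fact (k - j))) * exp (- \<mu>) * exp (- \<nu>)"
    by (simp add: poisson_mass_def divide_inverse mult_ac)
  also have "\<dots> = (\<Sum>j\<le>k. poisson_mass \<mu> j * poisson_mass \<nu> (k - j))"
    unfolding sum_distrib_right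
    by (intro sum.cong refl) (simp add: poisson_mass_def divide_inverse mult_ac)
  finally show ?thesis .
qed

text \<open>The masses at \<open>p + r\<close> and \<open>p\<close> have ratio
  \<open>\<mu> ^ r\<close> over a constant, so their comparison is a threshold condition on a
  quantity increasing in \<mu>.\<close>

lemma poisson_mass_less_iff:
  assumes "0 < \<mu>"
  shows "poisson_mass \<mu> p < poisson_mass \<mu> (p + r) \<longleftrightarrow> fact (p + r) / fact p < \<mu> ^ r"
proof -
  define q :: real where "q = fact (p + r) / fact p"
  have "0 < poisson_mass \<mu> p"
    using assms by (simp add: poisson_mass_def)
  note cancel = mult_less_cancel_left_pos[OF this, of 1 "\<mu> ^ r / q"]
  have "poisson_mass \<mu> (p + r) = poisson_mass \<mu> p * (\<mu> ^ r / q)"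
    by (simp add: poisson_mass_def power_add q_def)
  with cancel have "poisson_mass \<mu> p < poisson_mass \<mu> (p + r) \<longleftrightarrow> 1 < \<mu> ^ r / q"
    by (simp only: mult_1_right)
  also have "\<dots> \<longleftrightarrow> q < \<mu> ^ r"
    by (simp add: q_def less_divide_eq_1_pos del: divide_divide_eq_right)
  finally show ?thesis
    by (simp only: q_def)
qed

text \<open>The mass at k has derivative mass at k - 1 minus mass at k, with no first term for k =
  0, so only the last mass survives summation. The case distinction avoids the truncated
  \<open>m - 1\<close> at 0.\<close>

lemma has_derivative_sum_poisson_mass:
  "((\<lambda>\<mu>. \<Sum>k<m. poisson_mass \<mu> k) has_real_derivative
     (if m = 0 then 0 else - poisson_mass x (m - 1))) (at x)"
proof (induction m)
  case 0
  then show ?case by simp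
next
  case (Suc m)
  have "((\<lambda>\<mu>. poisson_mass \<mu> m) has_real_derivative
      (if m = 0 then 0 else poisson_mass x (m - 1)) - poisson_mass x m) (at x)"
  proof (cases m)
    case 0
    then show ?thesis
      by (auto simp: poisson_mass_def intro!: derivative_eq_intros)
  next
    case (Suc j)
    have "((\<lambda>\<mu>. \<mu> ^ Suc j * exp (- \<mu>) / fact (Suc j)) has_real_derivative
        (real (Suc j) * x ^ j * exp (- x) - x ^ Suc j * exp (- x)) / fact (Suc j)) (at x)"
      by (auto intro!: derivative_eq_intros simp del: power_Suc of_nat_Suc fact_Suc)
    also have "(real (Suc j) * x ^ j * exp (- x) - x ^ Suc j * exp (- x)) / fact (Suc j) =
        x ^ j * exp (- x) / fact j - x ^ Suc j * exp (- x) / fact (Suc j)"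
      by (simp add: diff_divide_distrib del: power_Suc of_nat_Suc)
    finally show ?thesis
      using Suc by (simp add: poisson_mass_def del: power_Suc fact_Suc)
  qed
  from DERIV_add[OF Suc this] show ?case
    by (simp split: if_splits)
qed

text \<open>A value at x below both ends would give, by the mean value theorem, a negative slope
  left of x and a positive one to its right. But a slope that is negative once stays
  negative.\<close>

lemma sum_poisson_mass_quasiconcave:
  fixes c x d :: real
  assumes "0 \<le> c" "c < x" "x < d"
  shows "min (\<Sum>k=g..<h. poisson_mass c k) (\<Sum>k=g..<h. poisson_mass d k)
    \<le> (\<Sum>k=g..<h. poisson_mass x k)"
proof (cases "g < h")
  case True
  define f where "f = (\<lambda>\<mu>. \<Sum>k=g..<h. poisson_mass \<mu> k)"
  define f' where "f' = (\<lambda>\<mu>. (if g = 0 then 0 else poisson_mass \<mu> (g - 1)) - poisson_mass \<mu> (h - 1))"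
  have f_eq: "f = (\<lambda>\<mu>. (\<Sum>k<h. poisson_mass \<mu> k) - (\<Sum>k<g. poisson_mass \<mu> k))"
    using True by (auto simp: f_def fun_eq_iff lessThan_atLeast0 sum_diff_nat_ivl)
  have deriv: "(f has_real_derivative f' \<mu>) (at \<mu>)" for \<mu>
    unfolding f_eq f'_def
    by (rule DERIV_cong[OF DERIV_diff[OF has_derivative_sum_poisson_mass has_derivative_sum_poisson_mass]])
      (use True in auto)
  show ?thesis
  proof (rule ccontr)
    assume "\<not> ?thesis"
    then have less: "f x < f c" "f x < f d"
      by (auto simp: f_def)
    obtain \<xi> where \<xi>: "c < \<xi>" "\<xi> < x" "f x - f c = (x - c) * f' \<xi>"
      using MVT2[OF \<open>c < x\<close>, of f f'] deriv by blast
    obtain \<eta> where \<eta>: "x < \<eta>" "\<eta> < d" "f d - f x = (d - x) * f' \<eta>"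
      using MVT2[OF \<open>x < d\<close>, of f f'] deriv by blast
    have neg: "f' \<xi> < 0"
      using \<xi> less assms by (smt (verit) mult_nonneg_nonneg)
    have pos: "0 < f' \<eta>"
      using \<eta> less assms by (smt (verit) mult_nonneg_nonpos)
    have \<xi>\<eta>: "0 < \<xi>" "\<xi> < \<eta>"
      using \<xi> \<eta> assms by auto
    \<comment> \<open>For g = 0 the slope is minus a mass and cannot be positive.\<close>
    have "g \<noteq> 0"
      using pos \<xi>\<eta> poisson_mass_nonneg[of \<eta> "h - 1"] by (auto simp: f'_def split: if_splits)
    define r where "r = h - g"
    have h: "h - 1 = (g - 1) + r"
      using True \<open>g \<noteq> 0\<close> by (simp add: r_def)
    \<comment> \<open>The left side says that the slope at \<mu> is negative; the right side
      persists when \<mu> grows.\<close>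
    have sgn: "poisson_mass \<mu> (g - 1) < poisson_mass \<mu> (h - 1) \<longleftrightarrow>
        fact (h - 1) / fact (g - 1) < \<mu> ^ r" if "0 < \<mu>" for \<mu>
      unfolding h by (rule poisson_mass_less_iff[OF that])
    have "fact (h - 1) / fact (g - 1) < \<xi> ^ r"
      using neg sgn[of \<xi>] \<xi>\<eta> \<open>g \<noteq> 0\<close> by (simp add: f'_def)
    also have "\<dots> \<le> \<eta> ^ r"
      using \<xi>\<eta> by (intro power_mono) auto
    finally have "f' \<eta> < 0"
      using sgn[of \<eta>] \<xi>\<eta> \<open>g \<noteq> 0\<close> by (simp add: f'_def)
    with pos show False by simp
  qed
qed simp

section \<open>Coverage probability as a sum of Poisson masses\<close>

text \<open>Strict bounds on an integer round to floor plus one and ceiling; \<open>nat\<close>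
  clips negative bounds to 0, which loses no natural number.\<close>

lemma covered_eq_ivl:
  assumes "0 < n"
  shows "covered n \<epsilon> lam =
    {nat (\<lfloor>real n * (lam - \<epsilon>)\<rfloor> + 1)..<nat \<lceil>real n * (lam + \<epsilon>)\<rceil>}"
proof -
  have "\<bar>real k / real n - lam\<bar> < \<epsilon> \<longleftrightarrow>
      real n * (lam - \<epsilon>) < real_of_int (int k) \<and> real_of_int (int k) < real n * (lam + \<epsilon>)" for k
    using assms by (auto simp: abs_less_iff field_simps)
  then have "\<bar>real k / real n - lam\<bar> < \<epsilon> \<longleftrightarrow>
      \<lfloor>real n * (lam - \<epsilon>)\<rfloor> < int k \<and> int k < \<lceil>real n * (lam + \<epsilon>)\<rceil>" for k
    by (simp only: floor_less_iff less_ceiling_iff)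
  then show ?thesis
    by (auto simp only: set_eq_iff covered_def mem_Collect_eq atLeastLessThan_iff nat_le_iff
        zless_nat_eq_int_zless add1_zle_eq)
qed

text \<open>Partial sums up to m \<le> n allow induction on m while the independent family over
  \<open>{1..n}\<close> stays fixed.\<close>

lemma iid_poisson_sum:
  assumes "iid_poisson M X n lam" "m \<le> n"
  shows "measure M {\<omega> \<in> space M. (\<Sum>i=1..m. X i \<omega>) = k} = poisson_mass (real m * lam) k"
  using assms(2)
proof (induction m arbitrary: k)
  interpret prob_space M using assms(1) by (simp add: iid_poisson_def)
  case 0
  \<comment> \<open>The empty sum is 0, and mean 0 gives the point mass at 0 because
    \<open>0 ^ 0 = 1\<close>.\<close>
  show ?case
    by (cases k) (auto simp: poisson_mass_def prob_space)
next
  interpret prob_space M using assms(1) by (simp add: iid_poisson_def)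
  case (Suc m)
  let ?S = "\<lambda>\<omega>. \<Sum>i=1..m. X i \<omega>"
  have indep: "indep_vars (\<lambda>_. count_space UNIV) X {1..n}"
    using assms(1) by (simp add: iid_poisson_def)
  have X: "X i \<in> measurable M (count_space UNIV)" if "i \<in> {1..n}" for i
    using indep that by (auto simp: indep_vars_def)
  have [measurable]: "X (Suc m) \<in> measurable M (count_space UNIV)"
    using X Suc.prems by simp
  have [measurable]: "?S \<in> measurable M (count_space UNIV)"
    using X Suc.prems by (intro measurable_sum_nat) auto
  \<comment> \<open>\<open>indep_vars_sum\<close> speaks of real-valued variables, so the counts are
    embedded in the reals; real singletons then recover the events for the counts.\<close>
  have "indep_vars (\<lambda>_. borel) (\<lambda>i \<omega>. real (X i \<omega>)) {1..n}"
    by (rule indep_vars_compose2[OF indep]) simp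
  then have "indep_vars (\<lambda>_. borel) (\<lambda>i \<omega>. real (X i \<omega>)) (insert (Suc m) {1..m})"
    by (rule indep_vars_subset) (use Suc.prems in auto)
  then have "indep_var borel (\<lambda>\<omega>. real (X (Suc m) \<omega>)) borel (\<lambda>\<omega>. \<Sum>i=1..m. real (X i \<omega>))"
    by (intro indep_vars_sum) auto
  then have split: "prob {\<omega> \<in> space M. X (Suc m) \<omega> = j \<and> ?S \<omega> = l} =
      prob {\<omega> \<in> space M. X (Suc m) \<omega> = j} * prob {\<omega> \<in> space M. ?S \<omega> = l}" for j l
    using indep_varD[of borel "\<lambda>\<omega>. real (X (Suc m) \<omega>)" borel "\<lambda>\<omega>. \<Sum>i=1..m. real (X i \<omega>)"
        "{real j}" "{real l}"]
    by (simp add: vimage_def Int_def conj_commute flip: of_nat_sum)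
  have events: "{\<omega> \<in> space M. X (Suc m) \<omega> = j \<and> ?S \<omega> = l} \<in> events" for j l
    by measurable
  have "{\<omega> \<in> space M. (\<Sum>i=1..Suc m. X i \<omega>) = k} =
      (\<Union>j\<le>k. {\<omega> \<in> space M. X (Suc m) \<omega> = j \<and> ?S \<omega> = k - j})"
    by auto
  also have "prob \<dots> = (\<Sum>j\<le>k. prob {\<omega> \<in> space M. X (Suc m) \<omega> = j \<and> ?S \<omega> = k - j})"
    using events by (intro finite_measure_finite_Union) (auto simp: disjoint_family_on_def)
  also have "\<dots> = (\<Sum>j\<le>k. poisson_mass lam j * poisson_mass (real m * lam) (k - j))"
    unfolding split using assms(1) Suc by (simp add: iid_poisson_def poisson_mass_def del: One_nat_def)
  also have "\<dots> = poisson_mass (real (Suc m) * lam) k"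
    by (simp add: poisson_mass_add[symmetric] algebra_simps)
  finally show ?case .
qed

lemma coverage_eq_sum:
  assumes "iid_poisson M X n lam" "0 < n"
  shows "coverage M X n \<epsilon> lam = (\<Sum>k\<in>covered n \<epsilon> lam. poisson_mass (real n * lam) k)"
proof -
  interpret prob_space M using assms(1) by (simp add: iid_poisson_def)
  have [measurable]: "(\<lambda>\<omega>. \<Sum>i=1..n. X i \<omega>) \<in> measurable M (count_space UNIV)"
    using assms(1) by (intro measurable_sum_nat) (auto simp: iid_poisson_def indep_vars_def)
  have events: "{\<omega> \<in> space M. (\<Sum>i=1..n. X i \<omega>) = k} \<in> events" for k
    by measurable
  have "{\<omega> \<in> space M. \<bar>sample_mean X n \<omega> - lam\<bar> < \<epsilon>} =
      (\<Union>k\<in>covered n \<epsilon> lam. {\<omega> \<in> space M. (\<Sum>i=1..n. X i \<omega>) = k})"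
    by (auto simp: sample_mean_def covered_def)
  then have "coverage M X n \<epsilon> lam =
      prob (\<Union>k\<in>covered n \<epsilon> lam. {\<omega> \<in> space M. (\<Sum>i=1..n. X i \<omega>) = k})"
    by (simp add: coverage_def)
  also have "\<dots> = (\<Sum>k\<in>covered n \<epsilon> lam. prob {\<omega> \<in> space M. (\<Sum>i=1..n. X i \<omega>) = k})"
    using assms(2) events
    by (intro finite_measure_finite_Union) (auto simp: disjoint_family_on_def covered_eq_ivl)
  also have "\<dots> = (\<Sum>k\<in>covered n \<epsilon> lam. poisson_mass (real n * lam) k)"
    by (simp only: iid_poisson_sum[OF assms(1) order_refl])
  finally show ?thesis .
qed

section \<open>Size of the candidate set\<close>

lemma finite_card_int_between:
  fixes u v :: real
  assumes "u < v"
  shows "finite {l::int. u < l \<and> l < v}" and "real (card {l::int. u < l \<and> l < v}) < v - u + 1"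
proof -
  have eq: "{l::int. u < l \<and> l < v} = {\<lfloor>u\<rfloor><..<\<lceil>v\<rceil>}"
    by (auto simp: floor_less_iff less_ceiling_iff)
  show "finite {l::int. u < l \<and> l < v}"
    by (simp add: eq)
  \<comment> \<open>Keeps the cardinality of the integer interval from being truncated at 0.\<close>
  have "\<lfloor>u\<rfloor> + 1 \<le> \<lceil>v\<rceil>"
    using assms by linarith
  then have "real (card {l::int. u < l \<and> l < v}) = of_int \<lceil>v\<rceil> - of_int \<lfloor>u\<rfloor> - 1"
    by (simp add: eq)
  \<comment> \<open>Each rounding moves its endpoint by less than 1.\<close>
  also have "\<dots> < v - u + 1"
    by linarith
  finally show "real (card {l::int. u < l \<and> l < v}) < v - u + 1" .
qed

text \<open>Subtracting s and scaling by n sends the grid points to integers in an open interval of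
  length n(b - a). Both grids of candidates are instances, with s = \<epsilon> and s =
  -\<epsilon>.\<close>

lemma finite_card_shifted_grid:
  fixes a b s :: real
  assumes "a < b" "0 < n"
  defines "G \<equiv> {x \<in> {a<..<b}. \<exists>l::int. x = real_of_int l / real n + s}"
  shows "finite G" and "real (card G) < real n * (b - a) + 1"
proof -
  define L where "L = {l::int. real n * (a - s) < l \<and> l < real n * (b - s)}"
  have "real n * (a - s) < real n * (b - s)"
    using assms by simp
  from finite_card_int_between[OF this]
  have L: "finite L" "real (card L) < real n * (b - a) + 1"
    by (simp_all add: L_def algebra_simps)
  have "G \<subseteq> (\<lambda>l. real_of_int l / real n + s) ` L"
  proof
    fix x assume "x \<in> G"
    then obtain l :: int where l: "x = real_of_int l / real n + s" "a < x" "x < b"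
      by (auto simp: G_def)
    then have "real_of_int l = real n * (x - s)"
      using assms(2) by simp
    with l have "l \<in> L"
      using assms(2) by (simp add: L_def)
    with l(1) show "x \<in> (\<lambda>l. real_of_int l / real n + s) ` L"
      by blast
  qed
  with L show "finite G" "real (card G) < real n * (b - a) + 1"
    using finite_subset surj_card_le[of L G] by fastforce+
qed

lemma finite_card_candidate_set:
  assumes "a < b" "0 < n"
  shows "finite (candidate_set n \<epsilon> a b)"
    and "real (card (candidate_set n \<epsilon> a b)) < 2 * real n * (b - a) + 4"
proof -
  define G where "G = (\<lambda>s. {x \<in> {a<..<b}. \<exists>l::int. x = real_of_int l / real n + s})"
  have eq: "candidate_set n \<epsilon> a b = {a, b} \<union> G \<epsilon> \<union> G (- \<epsilon>)"
    by (simp add: candidate_set_def G_def)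
  have G: "finite (G s)" "real (card (G s)) < real n * (b - a) + 1" for s
    unfolding G_def by (rule finite_card_shifted_grid[OF assms])+
  show "finite (candidate_set n \<epsilon> a b)"
    using G by (simp add: eq)
  have "card (candidate_set n \<epsilon> a b) \<le> card {a, b} + card (G \<epsilon>) + card (G (- \<epsilon>))"
    unfolding eq using card_Un_le[of "{a, b} \<union> G \<epsilon>" "G (- \<epsilon>)"] card_Un_le[of "{a, b}" "G \<epsilon>"]
    by linarith
  moreover have "card {a, b} = 2"
    using assms by simp
  ultimately show "real (card (candidate_set n \<epsilon> a b)) < 2 * real n * (b - a) + 4"
    using G(2)[of \<epsilon>] G(2)[of "- \<epsilon>"] by linarith
qed

section \<open>Comparison with neighbouring candidates\<close>

text \<open>Moving from \<open>c\<close> to \<open>x\<close>, a count can only drop out of the covered set at a candidate.\<close>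

lemma covered_subset:
  assumes "x \<in> {a<..<b}" "c \<in> {a..b}"
    and no_candidate: "closed_segment c x \<inter> candidate_set n \<epsilon> a b \<subseteq> {c}" "x \<noteq> c"
  shows "covered n \<epsilon> c \<subseteq> covered n \<epsilon> x"
proof
  fix k assume "k \<in> covered n \<epsilon> c"
  then have k: "\<bar>real k / real n - c\<bar> < \<epsilon>"
    by (simp add: covered_def)
  show "k \<in> covered n \<epsilon> x"
  proof (rule ccontr)
    assume "k \<notin> covered n \<epsilon> x"
    then have "\<epsilon> \<le> \<bar>real k / real n - x\<bar>"
      by (simp add: covered_def)
    with k consider "c < real k / real n + \<epsilon>" "real k / real n + \<epsilon> \<le> x"
      | "x \<le> real k / real n - \<epsilon>" "real k / real n - \<epsilon> < c"
      by linarith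
    \<comment> \<open>The point y is where k stops being covered. It differs from c because k is
      strictly covered there, so it also lies strictly inside (a, b).\<close>
    then obtain y where y: "y \<in> closed_segment c x" "y \<noteq> c"
      "\<exists>l::int. y = real_of_int l / real n + \<epsilon> \<or> y = real_of_int l / real n - \<epsilon>"
    proof cases
      case 1
      then show ?thesis
        by (intro that[of "real k / real n + \<epsilon>"])
          (auto simp: closed_segment_eq_real_ivl intro!: exI[of _ "int k"])
    next
      case 2
      then show ?thesis
        by (intro that[of "real k / real n - \<epsilon>"])
          (auto simp: closed_segment_eq_real_ivl intro!: exI[of _ "int k"])
    qed
    then have "y \<in> {a<..<b}"
      using assms(1,2) by (auto simp: closed_segment_eq_real_ivl split: if_splits)
    with y have "y \<in> candidate_set n \<epsilon> a b"
      by (auto simp: candidate_set_def)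
    with y no_candidate show False
      by auto
  qed
qed

theorem theorem1:
  fixes M :: "real \<Rightarrow> 'a measure" and X :: "real \<Rightarrow> nat \<Rightarrow> 'a \<Rightarrow> nat"
    and n :: nat and \<epsilon> a b :: real
  assumes "0 < \<epsilon>" and "\<epsilon> < 1" and "0 \<le> a" and "a < b" and "0 < n"
    and "\<And>lam. lam \<in> {a..b} \<Longrightarrow> iid_poisson (M lam) (X lam) n lam"
  shows "(\<exists>x \<in> candidate_set n \<epsilon> a b.
            is_arg_min (\<lambda>lam. coverage (M lam) (X lam) n \<epsilon> lam) (\<lambda>lam. lam \<in> {a..b}) x)
       \<and> finite (candidate_set n \<epsilon> a b)
       \<and> real (card (candidate_set n \<epsilon> a b)) < 2 * real n * (b - a) + 4"
proof -
  let ?C = "candidate_set n \<epsilon> a b"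
  define cov where "cov = (\<lambda>lam. coverage (M lam) (X lam) n \<epsilon> lam)"
  have cov_eq: "cov lam = (\<Sum>k\<in>covered n \<epsilon> lam. poisson_mass (real n * lam) k)"
    if "lam \<in> {a..b}" for lam
    unfolding cov_def using that assms by (intro coverage_eq_sum) auto
  have fin: "finite ?C"
    using finite_card_candidate_set assms by blast
  have C: "a \<in> ?C" "b \<in> ?C" "?C \<subseteq> {a..b}"
    using assms by (auto simp: candidate_set_def)
  \<comment> \<open>This reduces the minimum over the interval to one over a finite set. It also
    settles that the minimum is attained, with no appeal to continuity of the coverage.\<close>
  have dominated: "\<exists>y\<in>?C. cov y \<le> cov x" if x: "x \<in> {a..b}" for x
  proof (cases "x \<in> ?C")
    case False
    with C x have x': "x \<in> {a<..<b}"
      by (auto simp: less_le)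
    \<comment> \<open>The candidates adjacent to x; they exist because a and b are
      candidates.\<close>
    define c where "c = Max {y \<in> ?C. y < x}"
    define d where "d = Min {y \<in> ?C. x < y}"
    have ne: "{y \<in> ?C. y < x} \<noteq> {}" "{y \<in> ?C. x < y} \<noteq> {}"
      using C x' by auto
    have c: "c \<in> ?C" "c < x" "\<And>y. y \<in> ?C \<Longrightarrow> y < x \<Longrightarrow> y \<le> c"
      using Max_in[OF _ ne(1)] fin by (auto simp: c_def)
    have d: "d \<in> ?C" "x < d" "\<And>y. y \<in> ?C \<Longrightarrow> x < y \<Longrightarrow> d \<le> y"
      using Min_in[OF _ ne(2)] fin by (auto simp: d_def)
    have cd: "c \<in> {a..b}" "d \<in> {a..b}"
      using c(1) d(1) C by auto
    have "closed_segment c x \<inter> ?C \<subseteq> {c}"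
      using c False by (force simp: closed_segment_eq_real_ivl less_le)
    then have subc: "covered n \<epsilon> c \<subseteq> covered n \<epsilon> x"
      using x' cd c by (intro covered_subset) auto
    have "closed_segment d x \<inter> ?C \<subseteq> {d}"
      using d False by (force simp: closed_segment_eq_real_ivl less_le)
    then have subd: "covered n \<epsilon> d \<subseteq> covered n \<epsilon> x"
      using x' cd d by (intro covered_subset) auto
    obtain g h where K: "covered n \<epsilon> x = {g..<h}"
      using covered_eq_ivl[OF \<open>0 < n\<close>] by blast
    \<comment> \<open>Enlarging the covered set of y to that of x only adds nonnegative
      masses.\<close>
    have le: "cov y \<le> (\<Sum>k\<in>{g..<h}. poisson_mass (real n * y) k)"
      if "y \<in> {a..b}" "covered n \<epsilon> y \<subseteq> covered n \<epsilon> x" for y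
      using that assms(3) K unfolding cov_eq[OF that(1)]
      by (intro sum_mono2) (auto intro: poisson_mass_nonneg)
    have "min (cov c) (cov d) \<le> min (\<Sum>k=g..<h. poisson_mass (real n * c) k)
        (\<Sum>k=g..<h. poisson_mass (real n * d) k)"
      using le[OF cd(1) subc] le[OF cd(2) subd] by linarith
    also have "\<dots> \<le> (\<Sum>k=g..<h. poisson_mass (real n * x) k)"
      using c(2) d(2) cd(1) assms(3,5) by (intro sum_poisson_mass_quasiconcave) auto
    also have "\<dots> = cov x"
      using x K by (simp add: cov_eq)
    finally show ?thesis
      using c(1) d(1) by (auto simp: min_le_iff_disj)
  qed auto
  obtain z where z: "z \<in> ?C" "\<And>y. y \<in> ?C \<Longrightarrow> cov z \<le> cov y"
    using fin C(1) by (metis arg_min_least arg_min_if_finite(1) empty_iff)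
  have "is_arg_min cov (\<lambda>lam. lam \<in> {a..b}) z"
    unfolding is_arg_min_linorder using z C(3) dominated by (meson order_trans subsetD)
  with z(1) show ?thesis
    using finite_card_candidate_set[OF assms(4,5)] unfolding cov_def by blast
qed

end
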